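(* Let $f,g:[a,b]\to\mathbb{R}$ be integrable functions such that $0\le g(t)\le 1$ for all $t\in[a,b]$ and such that $\int_a^b g(t)\,df(t)$ exists. Put $\lambda:=\int_a^b g(t)\,dt$. If $f$ is of bounded variation on $[a,b]$, then $$\left|\int_a^{a+\lambda} f(t)\,dt-\int_a^b f(t)g(t)\,dt\right|\le\left[\int_{a+\lambda}^b g(t)\,dt\right]\cdot\bigvee_a^b(f)\le (b-a-\lambda)\cdot\bigvee_a^b(f),$$ and $$\left|\int_a^b f(t)g(t)\,dt-\int_{b-\lambda}^b f(t)\,dt\right|\le\left[\int_a^{b-\lambda} g(t)\,dt\right]\cdot\bigvee_a^b(f)\le (b-a-\lambda)\cdot\bigvee_a^b(f).$$
   Context: Here $a<b$ are real numbers, $\int_a^b g(t)\,df(t)$ denotes the Riemann–Stieltjes integral of $g$ with respect to $f$, and $\bigvee_a^b(f)$ denotes the total variation of $f$ on $[a,b]$. *)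

theory Defs
  imports "HOL-Analysis.Analysis"
begin

(* Library divisions of {a..b} consist of nonempty closed intervals K = {Inf K..Sup K} with
   pairwise disjoint interiors.  They may also contain degenerate intervals {c}; these
   contribute 0 to all sums below, so the sums are those over partitions
   a = x_0 < x_1 < ... < x_n = b. *)

(* Riemann-Stieltjes integral of g with respect to f over [a,b], as the limit of the
   tagged sums when the mesh tends to 0 (not merely along refinements of partitions). *)
definition has_RS_integral ::
    "(real \<Rightarrow> real) \<Rightarrow> (real \<Rightarrow> real) \<Rightarrow> real \<Rightarrow> real \<Rightarrow> real \<Rightarrow> bool" where
  "has_RS_integral g f a b I \<longleftrightarrow>
     (\<forall>e>0. \<exists>d>0. \<forall>p. p tagged_division_of {a..b} \<and> (\<forall>(t, K)\<in>p. diameter K < d) \<longrightarrow>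
        \<bar>(\<Sum>(t, K)\<in>p. g t * (f (Sup K) - f (Inf K))) - I\<bar> < e)"

definition RS_integrable ::
    "(real \<Rightarrow> real) \<Rightarrow> (real \<Rightarrow> real) \<Rightarrow> real \<Rightarrow> real \<Rightarrow> bool" where
  "RS_integrable g f a b \<longleftrightarrow> (\<exists>I. has_RS_integral g f a b I)"

definition variation_sums :: "(real \<Rightarrow> real) \<Rightarrow> real \<Rightarrow> real \<Rightarrow> real set" where
  "variation_sums f a b = {\<Sum>K\<in>D. \<bar>f (Sup K) - f (Inf K)\<bar> | D. D division_of {a..b}}"

definition bounded_variation :: "(real \<Rightarrow> real) \<Rightarrow> real \<Rightarrow> real \<Rightarrow> bool" where
  "bounded_variation f a b \<longleftrightarrow> bdd_above (variation_sums f a b)"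

(* Meaningful only under bounded_variation f a b: Sup is real-valued. *)
definition total_variation :: "(real \<Rightarrow> real) \<Rightarrow> real \<Rightarrow> real \<Rightarrow> real" where
  "total_variation f a b = Sup (variation_sums f a b)"

end

theory Submission
  imports Defs
begin

text \<open>
  With \<open>c = a + \<lambda>\<close> the functions \<open>1 - g\<close> on \<open>[a, c]\<close> and \<open>g\<close> on \<open>[c, b]\<close> have the same integral \<open>m\<close>,
  and the difference on the left-hand side is the difference of the integrals of \<open>f\<close> against these
  two weights. It does not change when a constant is subtracted from \<open>f\<close>; since the oscillation of
  \<open>f\<close> is at most its total variation \<open>V\<close>, a suitable constant leaves a function bounded by \<open>V / 2\<close>,
  so that each of the two integrals is at most \<open>m V / 2\<close>. The second inequality is the same argument
  with the weights \<open>g\<close> on \<open>[a, b - \<lambda>]\<close> and \<open>1 - g\<close> on \<open>[b - \<lambda>, b]\<close>.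
\<close>

text \<open>The interval between the two points extends to a division of \<open>{a..b}\<close>. The
  other terms of its variation sum are nonnegative, so a single increment is already below the
  supremum.\<close>

lemma abs_diff_le_total_variation:
  assumes "bounded_variation f a b" "x \<in> {a..b}" "y \<in> {a..b}"
  shows "\<bar>f x - f y\<bar> \<le> total_variation f a b"
proof -
  have *: "\<bar>f y - f x\<bar> \<le> total_variation f a b" if "x \<le> y" "a \<le> x" "y \<le> b" for x y
  proof -
    have "{{x..y}} division_of \<Union> {{x..y}}"
      using that division_of_self[of x y] by simp
    moreover have "\<Union> {{x..y}} \<subseteq> cbox a b"
      using that by simp
    ultimately obtain D where D: "{{x..y}} \<subseteq> D" "D division_of {a..b}"
      by (metis partial_division_extend_interval box_real(2))
    have "\<bar>f y - f x\<bar> = (\<Sum>K\<in>{{x..y}}. \<bar>f (Sup K) - f (Inf K)\<bar>)"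
      using that by simp
    also have "\<dots> \<le> (\<Sum>K\<in>D. \<bar>f (Sup K) - f (Inf K)\<bar>)"
      by (intro sum_mono2 division_of_finite[OF D(2)] D(1)) simp
    also have "\<dots> \<le> total_variation f a b"
      unfolding total_variation_def
    proof (rule cSup_upper)
      show "(\<Sum>K\<in>D. \<bar>f (Sup K) - f (Inf K)\<bar>) \<in> variation_sums f a b"
        unfolding variation_sums_def using D(2) by blast
      show "bdd_above (variation_sums f a b)"
        using assms(1) by (simp add: bounded_variation_def)
    qed
    finally show ?thesis .
  qed
  show ?thesis
    using *[of x y] *[of y x] assms by (cases "x \<le> y") auto
qed

lemma oscillation_le_imp_centre:
  fixes f :: "'a \<Rightarrow> real"
  assumes "\<And>x y. x \<in> S \<Longrightarrow> y \<in> S \<Longrightarrow> \<bar>f x - f y\<bar> \<le> V"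
  obtains k where "\<And>x. x \<in> S \<Longrightarrow> \<bar>f x - k\<bar> \<le> V / 2"
proof (cases "S = {}")
  case False
  then obtain z where z: "z \<in> S" by blast
  have bdd: "bdd_above (f ` S)"
  proof (rule bdd_aboveI2)
    show "f x \<le> f z + V" if "x \<in> S" for x
      using assms[OF that z] by linarith
  qed
  \<comment> \<open>All values lie between \<open>Sup (f\<close> S) - V\<open>and\<close>Sup (f
    \<open>S)\<close>; the constant is the midpoint of this range.\<close>
  have "\<bar>f x - (Sup (f ` S) - V / 2)\<bar> \<le> V / 2" if x: "x \<in> S" for x
  proof -
    have "f x \<le> Sup (f ` S)"
      using bdd x by (intro cSup_upper) auto
    moreover have "f y \<le> f x + V" if "y \<in> S" for y
      using assms[OF x that] by linarith
    then have "Sup (f ` S) \<le> f x + V"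
      using z by (intro cSup_least) auto
    ultimately show ?thesis by linarith
  qed
  then show thesis by (rule that)
qed (use that in simp)

text \<open>The left-hand side is the integral of \<open>(f x - k) * w x\<close>, which is dominated
  pointwise by \<open>B * w x\<close> because the weight is nonnegative.\<close>

lemma abs_weighted_integral_diff_const_le:
  fixes f w :: "real \<Rightarrow> real"
  assumes "w integrable_on S" "(\<lambda>x. f x * w x) integrable_on S"
    and "\<And>x. x \<in> S \<Longrightarrow> 0 \<le> w x" "\<And>x. x \<in> S \<Longrightarrow> \<bar>f x - k\<bar> \<le> B"
  shows "\<bar>integral S (\<lambda>x. f x * w x) - k * integral S w\<bar> \<le> B * integral S w"
proof -
  have "integral S (\<lambda>x. f x * w x) - k * integral S w = integral S (\<lambda>x. f x * w x - k * w x)"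
    using assms(1,2) by (subst integral_diff) (auto intro: integrable_on_mult_right)
  moreover have "norm (integral S (\<lambda>x. f x * w x - k * w x)) \<le> integral S (\<lambda>x. B * w x)"
  proof (rule integral_norm_bound_integral)
    show "(\<lambda>x. f x * w x - k * w x) integrable_on S" "(\<lambda>x. B * w x) integrable_on S"
      using assms(1,2) by (auto intro: integrable_diff integrable_on_mult_right)
    show "norm (f x * w x - k * w x) \<le> B * w x" if "x \<in> S" for x
    proof -
      have "norm (f x * w x - k * w x) = \<bar>f x - k\<bar> * w x"
        using assms(3)[OF that] by (simp add: left_diff_distrib[symmetric] abs_mult)
      then show ?thesis
        using assms(3,4)[OF that] by (simp add: mult_right_mono)
    qed
  qed
  ultimately show ?thesis by simp
qed

text \<open>One centre \<open>k\<close> serves both sets, and since the weights have equal mass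
  \<open>m\<close>, the terms \<open>k * m\<close> cancel. Each side then contributes at most
  \<open>m * V / 2\<close>.\<close>

lemma abs_diff_weighted_integrals_le:
  fixes f v w :: "real \<Rightarrow> real"
  assumes "v integrable_on S" "(\<lambda>x. f x * v x) integrable_on S"
    and "w integrable_on T" "(\<lambda>x. f x * w x) integrable_on T"
    and "\<And>x. x \<in> S \<Longrightarrow> 0 \<le> v x" "\<And>x. x \<in> T \<Longrightarrow> 0 \<le> w x"
    and "\<And>x y. x \<in> S \<union> T \<Longrightarrow> y \<in> S \<union> T \<Longrightarrow> \<bar>f x - f y\<bar> \<le> V"
    and "integral S v = m" "integral T w = m"
  shows "\<bar>integral S (\<lambda>x. f x * v x) - integral T (\<lambda>x. f x * w x)\<bar> \<le> m * V"
proof -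
  obtain k where k: "\<And>x. x \<in> S \<union> T \<Longrightarrow> \<bar>f x - k\<bar> \<le> V / 2"
    using oscillation_le_imp_centre assms(7) by metis
  have "\<bar>integral S (\<lambda>x. f x * v x) - k * m\<bar> \<le> V / 2 * m"
    using abs_weighted_integral_diff_const_le[of v S f k "V / 2"] assms k by auto
  moreover have "\<bar>integral T (\<lambda>x. f x * w x) - k * m\<bar> \<le> V / 2 * m"
    using abs_weighted_integral_diff_const_le[of w T f k "V / 2"] assms k by auto
  moreover have "V / 2 * m = m * V / 2" by simp
  ultimately show ?thesis by linarith
qed

text \<open>Gauge integrability is not preserved by products in general. Here \<open>g\<close> is
  absolutely integrable because it is nonnegative, and \<open>f\<close> is measurable and, having
  finite oscillation, bounded.\<close>

lemma integrable_mult_bounded_variation: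
  fixes f g :: "real \<Rightarrow> real"
  assumes "f integrable_on {a..b}" "g integrable_on {a..b}" "bounded_variation f a b"
    and "\<And>t. t \<in> {a..b} \<Longrightarrow> 0 \<le> g t"
  shows "(\<lambda>t. f t * g t) integrable_on {a..b}"
proof -
  have "bounded (f ` {a..b})"
    using abs_diff_le_total_variation[OF assms(3)]
    unfolding bounded_two_points ball_simps dist_real_def by blast
  moreover have "g absolutely_integrable_on {a..b}"
    using assms by (intro nonnegative_absolutely_integrable_1) auto
  ultimately have "(\<lambda>t. f t * g t) absolutely_integrable_on {a..b}"
    using assms(1) by (intro absolutely_integrable_bounded_measurable_product_real)
      (auto intro: integrable_imp_measurable)
  then show ?thesis
    by (rule set_lebesgue_integral_eq_integral)
qed

theorem theorem3:
  fixes f g :: "real \<Rightarrow> real" and a b lam :: real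
  assumes "a < b"
    and "f integrable_on {a..b}"
    and "g integrable_on {a..b}"
    and "\<And>t. t \<in> {a..b} \<Longrightarrow> 0 \<le> g t \<and> g t \<le> 1"
    and "RS_integrable g f a b"
    and "lam = integral {a..b} g"
    and "bounded_variation f a b"
  shows "\<bar>integral {a..a + lam} f - integral {a..b} (\<lambda>t. f t * g t)\<bar>
           \<le> integral {a + lam..b} g * total_variation f a b
       \<and> integral {a + lam..b} g * total_variation f a b
           \<le> (b - a - lam) * total_variation f a b
       \<and> \<bar>integral {a..b} (\<lambda>t. f t * g t) - integral {b - lam..b} f\<bar>
           \<le> integral {a..b - lam} g * total_variation f a b
       \<and> integral {a..b - lam} g * total_variation f a b
           \<le> (b - a - lam) * total_variation f a b"
proof -
  define V where "V = total_variation f a b"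
  have osc: "\<bar>f x - f y\<bar> \<le> V" if "x \<in> {a..b}" "y \<in> {a..b}" for x y
    using abs_diff_le_total_variation assms(7) that V_def by blast
  have V: "0 \<le> V"
    using osc[of a a] \<open>a < b\<close> by simp
  have fg: "(\<lambda>t. f t * g t) integrable_on {a..b}"
    using integrable_mult_bounded_variation assms by blast
  \<comment> \<open>Integrating \<open>0 \<le> g \<le> 1\<close> gives
    \<open>0 \<le> lam \<le> b - a\<close>, so both cut points \<open>a + lam\<close> and
    \<open>b - lam\<close> lie in \<open>{a..b}\<close>.\<close>
  have "0 \<le> lam"
    using assms by (auto intro: integral_nonneg)
  moreover have "lam \<le> integral {a..b} (\<lambda>_. 1)"
    unfolding assms(6) using assms by (intro integral_le) auto
  then have "lam \<le> b - a"
    using \<open>a < b\<close> by simp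
  ultimately have c: "a \<le> a + lam" "a + lam \<le> b" "a \<le> b - lam" "b - lam \<le> b"
    by auto
  have int: "f integrable_on {x..y}" "g integrable_on {x..y}" "(\<lambda>t. f t * g t) integrable_on {x..y}"
    if "a \<le> x" "y \<le> b" for x y
    using that assms(2,3) fg by (auto intro: integrable_subinterval_real)
  have one: "integral {x..y} (\<lambda>t. 1 - g t) = (y - x) - integral {x..y} g"
    "(\<lambda>t. 1 - g t) integrable_on {x..y}" if "a \<le> x" "x \<le> y" "y \<le> b" for x y
    using that int(2)[of x y] integral_diff[of "\<lambda>_. 1" "{x..y}" g]
      integrable_diff[of "\<lambda>_. 1" "{x..y}" g] by (simp_all add: integrable_const_ivl)
  have co: "integral {x..y} (\<lambda>t. f t * (1 - g t)) = integral {x..y} f - integral {x..y} (\<lambda>t. f t * g t)"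
    "(\<lambda>t. f t * (1 - g t)) integrable_on {x..y}" if "a \<le> x" "y \<le> b" for x y
    using integral_diff[OF int(1,3)[OF that]] integrable_diff[OF int(1,3)[OF that]]
    by (simp_all add: right_diff_distrib)
  have g_le: "integral {x..y} g \<le> y - x" if "a \<le> x" "x \<le> y" "y \<le> b" for x y
  proof -
    have "integral {x..y} g \<le> integral {x..y} (\<lambda>_. 1)"
      using that int[of x y] assms(4) by (intro integral_le) auto
    then show ?thesis using that by simp
  qed
  have split: "integral {a..x} g + integral {x..b} g = lam"
    "integral {a..x} (\<lambda>t. f t * g t) + integral {x..b} (\<lambda>t. f t * g t) = integral {a..b} (\<lambda>t. f t * g t)"
    if "a \<le> x" "x \<le> b" for x
    using Henstock_Kurzweil_Integration.integral_combine[OF that assms(3)]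
      Henstock_Kurzweil_Integration.integral_combine[OF that fg] assms(6) by simp_all

  have "\<bar>integral {a..a + lam} (\<lambda>t. f t * (1 - g t)) - integral {a + lam..b} (\<lambda>t. f t * g t)\<bar>
      \<le> integral {a + lam..b} g * V"
  proof (rule abs_diff_weighted_integrals_le)
    \<comment> \<open>The interval \<open>{a..a + lam}\<close> has length \<open>lam\<close>, the
      total mass of \<open>g\<close>; what \<open>g\<close> leaves of this length is exactly its
      mass on the rest.\<close>
    show "integral {a..a + lam} (\<lambda>t. 1 - g t) = integral {a + lam..b} g"
      using one(1)[of a "a + lam"] split(1)[of "a + lam"] c by linarith
    show "\<bar>f x - f y\<bar> \<le> V"
      if "x \<in> {a..a + lam} \<union> {a + lam..b}" "y \<in> {a..a + lam} \<union> {a + lam..b}" for x y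
      using that c by (intro osc) auto
  qed (use c assms(4) in \<open>auto intro!: int one co\<close>)
  \<comment> \<open>Expanding \<open>f t * (1 - g t)\<close> leaves the integral of \<open>f\<close>
    minus the two pieces of the integral of \<open>f t * g t\<close>, which join at
    \<open>a + lam\<close>.\<close>
  then have 1: "\<bar>integral {a..a + lam} f - integral {a..b} (\<lambda>t. f t * g t)\<bar>
      \<le> integral {a + lam..b} g * V"
    using c co(1)[of a "a + lam"] split(2)[of "a + lam"] by (simp add: diff_diff_eq)

  have "\<bar>integral {a..b - lam} (\<lambda>t. f t * g t) - integral {b - lam..b} (\<lambda>t. f t * (1 - g t))\<bar>
      \<le> integral {a..b - lam} g * V"
  proof (rule abs_diff_weighted_integrals_le)
    \<comment> \<open>The same mass balance, now with the interval of length \<open>lam\<close> at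
      the right end.\<close>
    show "integral {b - lam..b} (\<lambda>t. 1 - g t) = integral {a..b - lam} g"
      using one(1)[of "b - lam" b] split(1)[of "b - lam"] c by linarith
    show "\<bar>f x - f y\<bar> \<le> V"
      if "x \<in> {a..b - lam} \<union> {b - lam..b}" "y \<in> {a..b - lam} \<union> {b - lam..b}" for x y
      using that c by (intro osc) auto
  qed (use c assms(4) in \<open>auto intro!: int one co\<close>)
  then have 2: "\<bar>integral {a..b} (\<lambda>t. f t * g t) - integral {b - lam..b} f\<bar>
      \<le> integral {a..b - lam} g * V"
    using c co(1)[of "b - lam" b] split(2)[of "b - lam"] by (simp add: algebra_simps)

  \<comment> \<open>Both remaining intervals, \<open>{a + lam..b}\<close> and
    \<open>{a..b - lam}\<close>, have length \<open>b - a - lam\<close>, which bounds the integral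
    of \<open>g\<close> there.\<close>
  have "integral {a + lam..b} g * V \<le> (b - a - lam) * V"
    using g_le[of "a + lam" b] c V by (intro mult_right_mono) auto
  moreover have "integral {a..b - lam} g * V \<le> (b - a - lam) * V"
    using g_le[of a "b - lam"] c V by (intro mult_right_mono) auto
  ultimately show ?thesis
    using 1 2 unfolding V_def by blast
qed

end
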